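(* Let $S\ge1$, $N\ge0$ and $n\ge1$ be integers with $N+S$ odd, and let $L=2n$. Let $b^r\in\mathbb C^{S+1}$ and let $b^l=c\,U_I^\dagger b^r$ for some nonzero $c\in\mathbb C$, where $U_I=e^{i\pi S^y_a}$ (inversion-symmetry-preserving boundary conditions). Let $|SG\rangle$ be the spin-$S$ AKLT ground state on the open chain of $L$ sites with boundary vectors $b^l,b^r$, and suppose that the tower state $|SS_{2N}\rangle=(\hat{\mathcal O}_{SS_2})^N|SG\rangle$ is nonzero. Then every nonzero eigenvalue of the reduced density matrix of $|SS_{2N}\rangle$ on the half chain $\{1,\dots,n\}$ has even multiplicity; that is, the entanglement spectrum at the middle cut consists of exactly degenerate doublets at any finite size.
   Context: Let $S\ge1$ be an integer. Each site of a chain of $L$ sites carries a spin-$S$ with orthonormal basis $|m\rangle$, $m\in\{-S,\dots,S\}$ ($S^z$ eigenbasis), and $S_j^+$ denotes the spin raising operator on site $j$. Spin-$S$ AKLT ground states: let $I=\{S/2,S/2-1,\dots,-S/2\}$ index the standard $S^z$ eigenbasis of a spin-$S/2$ representation (dimension $S+1$). For $u,v\in I$ define, using Clebsch-Gordan coefficients (standard phase convention) for coupling two spins $S/2$, $$M^{[m]}_{uv}=\langle S,m\,|\,\tfrac S2,u;\tfrac S2,v\rangle \ (\text{zero unless } m=u+v),\qquad \Theta_{uv}=\langle \tfrac S2,u;\tfrac S2,v\,|\,0,0\rangle\ (\text{zero unless }u=-v),$$ and the $(S+1)\times(S+1)$ matrices $A^{[m]}=M^{[m]}\Theta$. The AKLT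 ground state on the open chain with boundary vectors $b^l,b^r\in\mathbb C^{S+1}$ is, up to normalization, $$|SG\rangle=\sum_{m_1,\dots,m_L}\left[(b^l)^TA^{[m_1]}A^{[m_2]}\cdots A^{[m_L]}b^r\right]|m_1m_2\cdots m_L\rangle .$$ $S^y_a$ is the $(S+1)\times(S+1)$ matrix of the spin-$S/2$ operator $S^y$ in the standard $S^z$ eigenbasis (so $e^{i\pi S^y_a}$ is a real antidiagonal matrix with entries $\pm1$). The tower of states is $|SS_{2N}\rangle=(\hat{\mathcal O}_{SS_2})^N|SG\rangle$ with $\hat{\mathcal O}_{SS_2}=\sum_{j=1}^{L}(-1)^j(S_j^+)^{2S}$. For a nonzero vector $|\psi\rangle$, its reduced density matrix on the half chain $\{1,\dots,n\}$ is the partial trace of $|\psi\rangle\langle\psi|$ over the sites $n+1,\dots,2n$. *)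

theory Defs
  imports "Jordan_Normal_Form.Schur_Decomposition"
begin

section \<open>Clebsch-Gordan coefficients\<close>

text \<open>Factorial of a real number that is a nonnegative integer.\<close>

definition rfact :: "real \<Rightarrow> real" where
  "rfact x = fact (nat \<lfloor>x\<rfloor>)"

text \<open>
  \<open>clebsch_gordan j1 m1 j2 m2 J M\<close> is the coefficient \<open>\<langle>j1,m1; j2,m2 | J,M\<rangle>\<close>, given by Racah's
  formula in the Condon-Shortley phase convention. These coefficients are real, so this is also
  \<open>\<langle>J,M | j1,m1; j2,m2\<rangle>\<close>. The spins \<open>j\<close> and projections \<open>m\<close> are meant to be integers or
  half-integers such that \<open>j1 + j2 + J\<close> and each \<open>j - m\<close> are integers. The sum runs over all \<open>k\<close>
  for which every factorial in the denominator has a nonnegative argument.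
\<close>

definition clebsch_gordan :: "real \<Rightarrow> real \<Rightarrow> real \<Rightarrow> real \<Rightarrow> real \<Rightarrow> real \<Rightarrow> real" where
  "clebsch_gordan j1 m1 j2 m2 J M =
    (if M = m1 + m2 \<and> \<bar>j1 - j2\<bar> \<le> J \<and> J \<le> j1 + j2 \<and> \<bar>m1\<bar> \<le> j1 \<and> \<bar>m2\<bar> \<le> j2 \<and> \<bar>M\<bar> \<le> J
     then
       sqrt ((2 * J + 1) * rfact (J + j1 - j2) * rfact (J - j1 + j2) * rfact (j1 + j2 - J)
             / rfact (j1 + j2 + J + 1))
       * sqrt (rfact (J + M) * rfact (J - M) * rfact (j1 - m1) * rfact (j1 + m1)
               * rfact (j2 - m2) * rfact (j2 + m2))
       * (\<Sum>k | real k \<le> j1 + j2 - J \<and> real k \<le> j1 - m1 \<and> real k \<le> j2 + m2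
                \<and> 0 \<le> J - j2 + m1 + real k \<and> 0 \<le> J - j1 - m2 + real k.
            (-1) ^ k
            / (fact k * rfact (j1 + j2 - J - real k) * rfact (j1 - m1 - real k)
               * rfact (j2 + m2 - real k) * rfact (J - j2 + m1 + real k)
               * rfact (J - j1 - m2 + real k)))
     else 0)"


section \<open>Spin operators\<close>

text \<open>The matrix element \<open>\<langle>j,m' | S\<^sup>+ | j,m\<rangle>\<close> of the spin-\<open>j\<close> raising operator.\<close>

definition raise_elem :: "real \<Rightarrow> real \<Rightarrow> real \<Rightarrow> real" where
  "raise_elem j m' m = (if m' = m + 1 then sqrt (j * (j + 1) - m * (m + 1)) else 0)"

text \<open>
  The basis \<open>S/2, S/2 - 1, \<dots>, -S/2\<close> of the auxiliary spin \<open>S/2\<close> is enumerated in this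
  (descending) order by the matrix indices \<open>0, \<dots>, S\<close>.
\<close>

definition aux_m :: "nat \<Rightarrow> nat \<Rightarrow> real" where
  "aux_m S i = real S / 2 - real i"

text \<open>\<open>S\<^sup>y = (S\<^sup>+ - S\<^sup>-) / 2i\<close> for the auxiliary spin \<open>S/2\<close>.\<close>

definition aux_Sy :: "nat \<Rightarrow> complex mat" where
  "aux_Sy S = mat (S + 1) (S + 1) (\<lambda>(a, b).
     (complex_of_real (raise_elem (real S / 2) (aux_m S a) (aux_m S b))
      - complex_of_real (raise_elem (real S / 2) (aux_m S b) (aux_m S a))) / (2 * \<i>))"

definition mat_exp :: "complex mat \<Rightarrow> complex mat" where
  "mat_exp X = mat (dim_row X) (dim_col X) (\<lambda>(a, b). \<Sum>k. (X ^\<^sub>m k) $$ (a, b) / fact k)"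

definition U_I :: "nat \<Rightarrow> complex mat" where
  "U_I S = mat_exp ((\<i> * complex_of_real pi) \<cdot>\<^sub>m aux_Sy S)"


section \<open>Spin-S AKLT ground states\<close>

definition aklt_M :: "nat \<Rightarrow> int \<Rightarrow> complex mat" where
  "aklt_M S m = mat (S + 1) (S + 1) (\<lambda>(a, b). complex_of_real
     (clebsch_gordan (real S / 2) (aux_m S a) (real S / 2) (aux_m S b) (real S) (real_of_int m)))"

definition aklt_Theta :: "nat \<Rightarrow> complex mat" where
  "aklt_Theta S = mat (S + 1) (S + 1) (\<lambda>(a, b). complex_of_real
     (clebsch_gordan (real S / 2) (aux_m S a) (real S / 2) (aux_m S b) 0 0))"

definition aklt_A :: "nat \<Rightarrow> int \<Rightarrow> complex mat" where
  "aklt_A S m = aklt_M S m * aklt_Theta S"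

text \<open>
  A state of a spin-\<open>S\<close> chain of \<open>L\<close> sites is given by its amplitudes in the product \<open>S\<^sup>z\<close> basis,
  as a function on the configurations \<open>[m\<^sub>1, \<dots>, m\<^sub>L]\<close> with entries in \<open>{-S..S}\<close>; its values
  elsewhere are irrelevant. Site \<open>j\<close> of the chain is list position \<open>j - 1\<close>.
\<close>

type_synonym state = "int list \<Rightarrow> complex"

definition configs :: "nat \<Rightarrow> nat \<Rightarrow> int list list" where
  "configs S L = List.n_lists L [- int S..int S]"

text \<open>In the following, \<open>\<bullet>\<close> is bilinear: the left boundary vector enters without conjugation.\<close>

definition aklt_state :: "nat \<Rightarrow> complex vec \<Rightarrow> complex vec \<Rightarrow> state" where
  "aklt_state S bl br ms =
     bl \<bullet> (foldr (\<lambda>m X. aklt_A S m * X) ms (1\<^sub>m (S + 1)) *\<^sub>v br)"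


section \<open>The tower of states\<close>

definition site_raise :: "nat \<Rightarrow> nat \<Rightarrow> state \<Rightarrow> state" where
  "site_raise S j \<psi> ms =
     (\<Sum>m\<in>{- int S..int S}.
        complex_of_real (raise_elem (real S) (real_of_int (ms ! (j - 1))) (real_of_int m))
        * \<psi> (ms[j - 1 := m]))"

definition tower_op :: "nat \<Rightarrow> nat \<Rightarrow> state \<Rightarrow> state" where
  "tower_op S L \<psi> ms = (\<Sum>j=1..L. (-1) ^ j * ((site_raise S j) ^^ (2 * S)) \<psi> ms)"

definition tower_state :: "nat \<Rightarrow> nat \<Rightarrow> nat \<Rightarrow> complex vec \<Rightarrow> complex vec \<Rightarrow> state" where
  "tower_state S L N bl br = ((tower_op S L) ^^ N) (aklt_state S bl br)"


section \<open>Reduced density matrices\<close>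

text \<open>
  The partial trace of \<open>|\<psi>\<rangle>\<langle>\<psi>|\<close> over the last \<open>k\<close> of \<open>n + k\<close> sites, as a matrix whose rows and
  columns are indexed by the positions in the list \<open>configs S n\<close>.
\<close>

definition reduced_density_matrix :: "nat \<Rightarrow> nat \<Rightarrow> nat \<Rightarrow> state \<Rightarrow> complex mat" where
  "reduced_density_matrix S n k \<psi> =
     mat (length (configs S n)) (length (configs S n)) (\<lambda>(a, b).
       \<Sum>r\<in>set (configs S k). \<psi> (configs S n ! a @ r) * cnj (\<psi> (configs S n ! b @ r)))"

end

theory Submission
  imports Defs "Subresultants.More_Homomorphisms"
begin

text \<open>
  Since \<open>M\<close> is symmetric, \<open>\<Theta>\<^sup>T = (-1)\<^sup>S \<Theta>\<close> and \<open>U_I\<close> is a multiple of \<open>\<Theta>\<close>, transposing the matrix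
  product shows that reversing the chain multiplies the ground state by \<open>(-1)\<^sup>S\<close> when \<open>L\<close> is even;
  each application of the tower operator contributes a further sign, as \<open>j \<mapsto> L + 1 - j\<close> flips
  \<open>(-1)\<^sup>j\<close>. Hence for odd \<open>N + S\<close> the tower state is odd under reversal, and indexing the right half
  by reversed configurations turns the amplitudes into a skew-symmetric matrix \<open>X\<close> with reduced
  density matrix \<open>\<rho> = X X\<^sup>\<dagger>\<close>. A determinant of a skew-symmetric matrix is a square, and
  \<open>t\<^sup>d det (t - \<rho>)\<close> is such a determinant over the polynomials, so its nonzero roots have even
  multiplicity.
\<close>

section \<open>Products of alternating matrices\<close>

text \<open>The zero diagonal is a separate condition because skew symmetry does not force it in
  characteristic 2, and the determinant lemmas below hold over arbitrary fields and domains.\<close>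

definition alternating_mat :: "nat \<Rightarrow> 'a::comm_ring_1 mat \<Rightarrow> bool" where
  "alternating_mat n A \<longleftrightarrow> A \<in> carrier_mat n n \<and>
     (\<forall>i<n. A $$ (i, i) = 0) \<and> (\<forall>i<n. \<forall>j<n. A $$ (j, i) = - A $$ (i, j))"

lemma alternating_matD:
  assumes "alternating_mat n A"
  shows "A \<in> carrier_mat n n"
    and "i < n \<Longrightarrow> A $$ (i, i) = 0"
    and "i < n \<Longrightarrow> j < n \<Longrightarrow> A $$ (j, i) = - A $$ (i, j)"
  using assms unfolding alternating_mat_def by blast+

text \<open>Block column elimination: multiplying on the right by the unipotent matrix
  \<open>?N\<close> clears the upper right block without changing the determinant.\<close>

lemma det_four_block_Schur:
  fixes A :: "'a::idom mat"
  assumes A: "A \<in> carrier_mat n n" and B: "B \<in> carrier_mat n m"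
    and C: "C \<in> carrier_mat m n" and D: "D \<in> carrier_mat m m"
    and A': "A' \<in> carrier_mat n n" and inv: "A * A' = 1\<^sub>m n"
  shows "det (four_block_mat A B C D) = det A * det (D - C * A' * B)"
proof -
  let ?N = "four_block_mat (1\<^sub>m n) (- (A' * B)) (0\<^sub>m m n) (1\<^sub>m m)"
  have A'B: "A' * B \<in> carrier_mat n m" using A' B by simp
  have e1: "A * (- (A' * B)) = - B"
    using A A' B A'B inv by (simp add: assoc_mult_mat[symmetric, of A n n A' n B m])
  have e2: "C * (- (A' * B)) + D = D - C * A' * B"
    using C A' B D A'B
    by (intro eq_matI) (simp_all add: assoc_mult_mat[of C m n A' n B m])
  have "four_block_mat A B C D * ?N = four_block_mat A (0\<^sub>m n m) C (D - C * A' * B)"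
    using A B C D A'B e1 e2
    by (subst mult_four_block_mat[OF A B C D, of _ n _ m]) auto
  moreover have "det ?N = 1"
    using A'B by (subst det_four_block_mat_lower_left_zero[where n = n and m = m]) auto
  moreover have "det (four_block_mat A B C D * ?N) = det (four_block_mat A B C D) * det ?N"
    using A D by (intro det_mult[of _ "n + m"]) auto
  moreover have "det (four_block_mat A (0\<^sub>m n m) C (D - C * A' * B)) = det A * det (D - C * A' * B)"
    using A B C D A' by (intro det_four_block_mat_upper_right_zero) auto
  ultimately show ?thesis by simp
qed

text \<open>Adding row \<open>i\<close> to row 1 and then column \<open>i\<close> to column 1 is a
  congruence by an elementary matrix of determinant 1, so it keeps both the alternating property and
  the determinant, while the pivot becomes \<open>A $$ (1, 0) + A $$ (i, 0)\<close>.\<close>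

lemma alternating_mat_pivot:
  fixes A :: "'a::idom mat"
  assumes A: "alternating_mat n A" and n: "2 \<le> n" and i: "i < n" and nz: "A $$ (i, 0) \<noteq> 0"
  obtains B where "alternating_mat n B" "det B = det A" "B $$ (1, 0) \<noteq> 0"
proof (cases "A $$ (1, 0) = 0")
  case False
  then show ?thesis using that A by blast
next
  case True
  note car = alternating_matD(1)[OF A]
  have i1: "1 \<noteq> i" and i0: "i \<noteq> 0" using nz True alternating_matD(2)[OF A, of 0] n
    by (metis, metis less_le_trans zero_less_numeral)
  let ?B = "addcol 1 1 i (addrow 1 1 i A)"
  have "det ?B = det A"
    using car i i1 by (subst det_addcol[where n = n]) (auto simp: det_addrow[where n = n])
  moreover have "?B $$ (1, 0) \<noteq> 0" using car n i i0 True nz by auto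
  moreover have "alternating_mat n ?B"
  proof -
    note z = alternating_matD(2)[OF A]
    have E: "?B $$ (k, l) = (A $$ (k, l) + (if k = 1 then A $$ (i, l) else 0)) +
        (if l = 1 then A $$ (k, i) + (if k = 1 then A $$ (i, i) else 0) else 0)" 
      if "k < n" "l < n" for k l
      using that car i n by auto
    have B0: "?B $$ (k, k) = 0" if k: "k < n" for k
      using z[OF k] z[OF i] alternating_matD(3)[OF A k i] unfolding E[OF k k]
      by (cases "k = i") auto
    have B1: "?B $$ (l, k) = - ?B $$ (k, l)" if kl: "k < n" "l < n" for k l
    proof (cases "k = l")
      case True
      then show ?thesis using B0[OF kl(1)] by simp
    next
      case False
      \<comment> \<open>Transposition exchanges the row contribution with the column contribution up
        to sign, so the added terms are matched crosswise.\<close>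
      have "(A $$ (l, k) + x) + y = - ((A $$ (k, l) + x') + y')"
        if "x = - y'" "y = - x'" for x y x' y'
        using that alternating_matD(3)[OF A kl] by simp
      then show ?thesis
        using False z[OF i] alternating_matD(3)[OF A i kl(1)] alternating_matD(3)[OF A i kl(2)]
        unfolding E[OF kl] E[OF kl(2,1)] by simp
    qed
    have "?B \<in> carrier_mat n n" using car by (intro carrier_matI) auto
    with B0 B1 show ?thesis unfolding alternating_mat_def by blast
  qed
  ultimately show ?thesis using that by blast
qed

text \<open>Induction in steps of two: a vanishing first column gives determinant 0; otherwise
  pivoting yields a leading 2x2 block of determinant \<open>a ^ 2\<close> whose Schur complement is
  again alternating.\<close>

lemma det_alternating_mat_square:
  fixes A :: "'a::field mat"
  assumes "alternating_mat n A"
  shows "\<exists>s. det A = s ^ 2"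
  using assms
proof (induction n arbitrary: A rule: less_induct)
  case (less n)
  note car = alternating_matD(1)[OF less.prems]
  consider "n = 0" | "n = 1" | m where "n = m + 2"
    by (metis One_nat_def Suc_1 add_2_eq_Suc' not0_implies_Suc)
  then show ?case
  proof cases
    case 1
    then have "det A = 1 ^ 2" using car by simp
    then show ?thesis by blast
  next
    case 2
    then have "det A = 0 ^ 2" using car alternating_matD(2)[OF less.prems, of 0] det_single[of A] by simp
    then show ?thesis by blast
  next
    case (3 m)
    show ?thesis
    proof (cases "\<exists>i<n. A $$ (i, 0) \<noteq> 0")
      case False
      then have "det A = 0 ^ 2"
        using laplace_expansion_column[OF car, of 0] 3 by simp
      then show ?thesis by blast
    next
      case True
      then obtain B where B: "alternating_mat n B" "det B = det A" "B $$ (1, 0) \<noteq> 0"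
        using alternating_mat_pivot[OF less.prems] 3 by (metis le_add2)
      define a where "a = B $$ (1, 0)"
      have a: "a \<noteq> 0" using B a_def by simp
      note carB = alternating_matD(1)[OF B(1)] and diag = alternating_matD(2)[OF B(1)]
        and skew = alternating_matD(3)[OF B(1)]
      define P where "P = mat 2 2 (\<lambda>(i, j). B $$ (i, j))"
      define Q where "Q = mat 2 m (\<lambda>(i, j). B $$ (i, j + 2))"
      define R where "R = mat m 2 (\<lambda>(i, j). B $$ (i + 2, j))"
      define T where "T = mat m m (\<lambda>(i, j). B $$ (i + 2, j + 2))"
      \<comment> \<open>The inverse of \<open>P\<close>, whose entries are 0 on the diagonal,
        \<open>- a\<close> above it and \<open>a\<close> below it.\<close>
      define P' where "P' = mat 2 2 (\<lambda>(i, j). if i = j then 0 else if i = 0 then 1 / a else - 1 / a)"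
      define D where "D = T - R * P' * Q"
      have shift: "Suc (Suc (i - 2)) = i" if "\<not> i < 2" for i
        using that by simp
      have Bblock: "B = four_block_mat P Q R T"
        using carB 3 by (intro eq_matI) (auto simp: P_def Q_def R_def T_def shift)
      have b01: "B $$ (0, 1) = - a" using skew[of 1 0] 3 a_def by simp
      have Pe: "P $$ (0,0) = 0" "P $$ (1,1) = 0" "P $$ (0,1) = - a" "P $$ (1,0) = a"
        using 3 diag b01 by (auto simp: P_def a_def)
      have two: "(i::nat) < 2 \<longleftrightarrow> i = 0 \<or> i = 1" for i by auto
      have Pe': "P' $$ (0,0) = 0" "P' $$ (1,1) = 0" "P' $$ (0,1) = 1 / a" "P' $$ (1,0) = - 1 / a"
        by (auto simp: P'_def)
      have inv: "P * P' = 1\<^sub>m 2"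
      proof (rule eq_matI)
        fix i j assume "i < dim_row (1\<^sub>m 2)" "j < dim_col (1\<^sub>m 2)"
        then have ij: "i < 2" "j < 2" by auto
        have "(P * P') $$ (i, j) = P $$ (i, 0) * P' $$ (0, j) + P $$ (i, 1) * P' $$ (1, j)"
          using ij by (simp add: scalar_prod_def P_def P'_def numeral_2_eq_2)
        then show "(P * P') $$ (i, j) = 1\<^sub>m 2 $$ (i, j)"
          using ij a unfolding two by (auto simp: Pe[simplified] Pe'[simplified])
      qed (auto simp: P_def P'_def)
      have "det P = (\<Sum>i<2. P $$ (i, 0) * cofactor P i 0)"
        by (rule laplace_expansion_column) (auto simp: P_def)
      also have "\<dots> = - (a * det (mat_delete P 1 0))"
        using Pe by (simp add: numeral_2_eq_2 cofactor_def)
      also have "det (mat_delete P 1 0) = P $$ (0, 1)"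
        by (subst det_single) (auto simp: P_def mat_delete_def)
      finally have detP: "det P = a ^ 2" using Pe by (simp add: power2_eq_square)
      have De: "D $$ (i, j) = B $$ (i + 2, j + 2) - (B $$ (i + 2, 0) * B $$ (1, j + 2) -
           B $$ (i + 2, 1) * B $$ (0, j + 2)) / a" if "i < m" "j < m" for i j
        using that unfolding D_def
        by (simp add: scalar_prod_def T_def R_def Q_def P'_def numeral_2_eq_2 diff_divide_distrib)
      \<comment> \<open>Exchanging \<open>i\<close> and \<open>j\<close> turns each of the two
        products in \<open>De\<close> into the other one, by skew symmetry of
        \<open>B\<close>.\<close>
      have "alternating_mat m D"
        unfolding alternating_mat_def
      proof (intro conjI allI impI)
        show "D \<in> carrier_mat m m" unfolding D_def
          by (intro minus_carrier_mat mult_carrier_mat[of _ _ 2]) (auto simp: T_def R_def Q_def P'_def)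
      next
        fix i assume "i < m"
        then show "D $$ (i, i) = 0"
          using skew[of 0 "i + 2"] skew[of 1 "i + 2"] diag[of "i + 2"] 3 by (simp add: De)
      next
        fix i j assume "i < m" "j < m"
        then show "D $$ (j, i) = - D $$ (i, j)"
          using skew[of 0 "i + 2"] skew[of 1 "i + 2"] skew[of 0 "j + 2"] skew[of 1 "j + 2"]
            skew[of "i + 2" "j + 2"] 3 by (simp add: De diff_divide_distrib mult.commute)
      qed
      then obtain s where s: "det D = s ^ 2" using less.IH[of m D] 3 by auto
      have "det B = det P * det D"
        unfolding Bblock D_def
        by (rule det_four_block_Schur[OF _ _ _ _ _ inv]) (auto simp: P_def Q_def R_def T_def P'_def)
      then have "det A = (a * s) ^ 2" using B(2) detP s by (simp add: power_mult_distrib)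
      then show ?thesis by blast
    qed
  qed
qed

text \<open>The square root found in the fraction field may have a denominator, whence the factor
  \<open>q ^ 2\<close>; it is harmless for parities of root orders.\<close>

lemma det_alternating_mat_square_idom:
  fixes A :: "'a::idom mat"
  assumes A: "alternating_mat n A"
  shows "\<exists>p q. q \<noteq> 0 \<and> det A * q ^ 2 = p ^ 2"
proof -
  have "alternating_mat n (map_mat to_fract A)"
    unfolding alternating_mat_def
  proof (intro conjI allI impI)
    fix i j assume "i < n" "j < n"
    then show "map_mat to_fract A $$ (j, i) = - map_mat to_fract A $$ (i, j)"
      using alternating_matD(1)[OF A] alternating_matD(3)[OF A, of i j] by simp
  qed (use alternating_matD(1,2)[OF A] in auto)
  then obtain s where s: "to_fract (det A) = s ^ 2"
    using det_alternating_mat_square by (metis to_fract_hom.hom_det)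
  obtain p q where pq: "s = Fract p q" "q \<noteq> 0" by (cases s) auto
  then have "s * to_fract q = to_fract p"
    by (simp add: to_fract_def eq_fract)
  then have "to_fract (det A * q ^ 2) = to_fract (p ^ 2)"
    by (metis s power_mult_distrib to_fract_hom.hom_mult to_fract_hom.hom_power)
  then show ?thesis using pq(2) by (auto simp del: to_fract_mult)
qed

section \<open>Even root orders of characteristic polynomials\<close>

lemma even_order_char_poly_mult_alternating:
  fixes X Y :: "'a::field mat"
  assumes X: "alternating_mat n X" and Y: "alternating_mat n Y" and \<mu>: "\<mu> \<noteq> 0"
  shows "even (Polynomial.order \<mu> (char_poly (X * Y)))"
proof -
  \<comment> \<open>The block matrix \<open>[[tX, t], [-t, -Y]]\<close> is alternating with determinant \<open>t\<^sup>n det (t - XY)\<close>.\<close>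
  have carX: "X \<in> carrier_mat n n" and carY: "Y \<in> carrier_mat n n"
    using X Y by (auto dest: alternating_matD(1))
  then have carXY: "X * Y \<in> carrier_mat n n" by simp
  define t :: "'a poly" where "t = [:0, 1:]"
  define c where "c = (\<lambda>a::'a. [:a:])"
  define A where "A = t \<cdot>\<^sub>m map_mat c X"
  define B where "B = t \<cdot>\<^sub>m (1\<^sub>m n :: 'a poly mat)"
  define C where "C = (- t) \<cdot>\<^sub>m (1\<^sub>m n :: 'a poly mat)"
  define D where "D = - map_mat c Y"
  have car: "A \<in> carrier_mat n n" "B \<in> carrier_mat n n" "C \<in> carrier_mat n n" "D \<in> carrier_mat n n"
    using carX carY by (auto simp: A_def B_def C_def D_def)
  have "alternating_mat (n + n) (four_block_mat A B C D)"
    unfolding alternating_mat_def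
  proof (intro conjI allI impI)
    show "four_block_mat A B C D \<in> carrier_mat (n + n) (n + n)" using car by auto
  next
    fix i assume "i < n + n"
    then show "four_block_mat A B C D $$ (i, i) = 0"
      using carX carY alternating_matD(2)[OF X, of i] alternating_matD(2)[OF Y, of "i - n"]
      by (auto simp: A_def B_def C_def D_def c_def)
  next
    fix i j assume "i < n + n" "j < n + n"
    then show "four_block_mat A B C D $$ (j, i) = - four_block_mat A B C D $$ (i, j)"
      using carX carY alternating_matD(3)[OF X, of i j]
        alternating_matD(3)[OF Y, of "i - n" "j - n"]
      by (auto simp: A_def B_def C_def D_def c_def)
  qed
  then obtain p q where pq: "q \<noteq> 0" "det (four_block_mat A B C D) * q ^ 2 = p ^ 2"
    using det_alternating_mat_square_idom by blast
  \<comment> \<open>The block formula needs the lower blocks \<open>C\<close> and \<open>D\<close>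
    to commute; \<open>C\<close> is scalar.\<close>
  have "det (four_block_mat A B C D) = det (A * D - B * C)"
    using car by (intro det_four_block_mat) (auto simp: C_def)
  also have "A * D - B * C = t \<cdot>\<^sub>m char_poly_matrix (X * Y)"
  proof -
    have "A * D = t \<cdot>\<^sub>m (map_mat c X * D)"
      unfolding A_def using carX car(4) by (intro mult_smult_assoc_mat) auto
    also have "map_mat c X * D = - (map_mat c X * map_mat c Y)"
      unfolding D_def using carX carY by (intro uminus_mult_right_mat) auto
    also have "map_mat c X * map_mat c Y = map_mat c (X * Y)"
      unfolding c_def by (rule map_poly_mult(1)[OF carX carY, symmetric])
    finally have AD: "A * D = t \<cdot>\<^sub>m - map_mat c (X * Y)" .
    have "B * C = t \<cdot>\<^sub>m (1\<^sub>m n * C)"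
      unfolding B_def using car(3) by (intro mult_smult_assoc_mat) auto
    also have "1\<^sub>m n * C = C" using car(3) by simp
    finally have BC: "B * C = t \<cdot>\<^sub>m C" .
    show ?thesis
    proof (rule eq_matI)
      fix i j assume "i < dim_row (t \<cdot>\<^sub>m char_poly_matrix (X * Y))"
        "j < dim_col (t \<cdot>\<^sub>m char_poly_matrix (X * Y))"
      then have ij: "i < n" "j < n" using carXY by (auto simp: char_poly_matrix_def)
      define z where "z = (X * Y) $$ (i, j)"
      have "(A * D - B * C) $$ (i, j) = - (t * c z) + t * (t * (if i = j then 1 else 0))"
        unfolding AD BC z_def using ij carXY
        by (simp add: C_def carX[THEN carrier_matD(1)] carY[THEN carrier_matD(2)]
            del: index_mult_mat(1))
      also have "\<dots> = t * ((if i = j then [:0, 1:] else 0) + [:- z:])"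
        by (simp add: c_def t_def)
      also have "\<dots> = (t \<cdot>\<^sub>m char_poly_matrix (X * Y)) $$ (i, j)"
        unfolding char_poly_matrix_def z_def
        using ij carXY by (simp add: carX[THEN carrier_matD(1)] carY[THEN carrier_matD(2)]
            del: index_mult_mat(1))
      finally show "(A * D - B * C) $$ (i, j) = (t \<cdot>\<^sub>m char_poly_matrix (X * Y)) $$ (i, j)" .
    qed (use car carXY in \<open>auto simp: char_poly_matrix_def\<close>)
  qed
  also have "det \<dots> = t ^ n * char_poly (X * Y)"
    using carrier_matD(2)[OF char_poly_matrix_closed[OF carXY]] unfolding char_poly_def by simp
  finally have eq: "t ^ n * char_poly (X * Y) * q ^ 2 = p ^ 2" using pq by simp
  have "char_poly (X * Y) \<noteq> 0" using degree_monic_char_poly[OF carXY] by auto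
  then have nz: "t ^ n * char_poly (X * Y) * q ^ 2 \<noteq> 0" "t ^ n * char_poly (X * Y) \<noteq> 0" "p \<noteq> 0"
    using pq eq by (auto simp: t_def)
  \<comment> \<open>\<open>t ^ n\<close> vanishes only at 0, so it adds nothing to the order at
    \<open>\<mu>\<close>, and the squares add even amounts.\<close>
  have "order \<mu> (t ^ n) = 0"
    using \<mu> by (intro order_0I) (auto simp: t_def)
  then have "order \<mu> (char_poly (X * Y)) + 2 * order \<mu> q = 2 * order \<mu> p"
    using arg_cong[OF eq, of "order \<mu>"] nz pq(1)
    by (simp add: order_mult power2_eq_square)
  then show ?thesis by presburger
qed

section \<open>The rotation by \<open>\<pi>\<close> about the y axis\<close>

text \<open>Indices descend in the projection, so the raising operator occupies the superdiagonal.
  The factor \<open>\<i>\<close> cancels against the denominator \<open>2 * \<i>\<close> and leaves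
  a real skew-symmetric tridiagonal matrix.\<close>

lemma aux_Sy_index:
  assumes "a \<le> S" "b \<le> S"
  shows "((\<i> * complex_of_real pi) \<cdot>\<^sub>m aux_Sy S) $$ (a, b) =
    complex_of_real pi / 2 * (if b = Suc a then sqrt (real (Suc a * (S - a)))
      else if a = Suc b then - sqrt (real (Suc b * (S - b))) else 0)"
proof -
  have r: "raise_elem (real S / 2) (aux_m S a) (aux_m S b) =
      (if b = Suc a then sqrt (real (Suc a * (S - a))) else 0)" if "a \<le> S" "b \<le> S" for a b
  proof -
    have "aux_m S a = aux_m S b + 1 \<longleftrightarrow> b = Suc a"
      by (auto simp: aux_m_def)
    moreover have "real S / 2 * (real S / 2 + 1) - aux_m S (Suc a) * (aux_m S (Suc a) + 1) =
        real (Suc a * (S - a))"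
      using that by (simp add: aux_m_def of_nat_diff field_simps)
    ultimately show ?thesis by (auto simp: raise_elem_def)
  qed
  have "((\<i> * complex_of_real pi) \<cdot>\<^sub>m aux_Sy S) $$ (a, b) =
      complex_of_real pi / 2 * (complex_of_real (raise_elem (real S / 2) (aux_m S a) (aux_m S b))
        - complex_of_real (raise_elem (real S / 2) (aux_m S b) (aux_m S a)))"
    using assms by (simp add: aux_Sy_def field_simps)
  then show ?thesis
    by (simp add: r[OF assms] r[OF assms(2,1)])
qed

text \<open>The coefficients are chosen before \<open>u\<close> and \<open>v\<close>, so that one
  expansion can be evaluated at several pairs of polynomials; \<open>rotor_expansion\<close> uses it
  at two.\<close>

definition homogeneous :: "nat \<Rightarrow> (complex poly \<Rightarrow> complex poly \<Rightarrow> complex poly) \<Rightarrow> bool" where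
  "homogeneous N F \<longleftrightarrow> (\<exists>c. \<forall>u v. F u v = (\<Sum>p\<le>N. smult (c p) (u ^ p * v ^ (N - p))))"

lemma homogeneous_mult_linear:
  assumes "homogeneous N F"
  shows "homogeneous (Suc N) (\<lambda>u v. (smult \<alpha> u + smult \<beta> v) * F u v)"
proof -
  obtain c where c: "F u v = (\<Sum>p\<le>N. smult (c p) (u ^ p * v ^ (N - p)))" for u v
    using assms by (auto simp: homogeneous_def)
  define d where "d p = (if p = 0 then 0 else \<alpha> * c (p - 1)) + (if p \<le> N then \<beta> * c p else 0)" for p
  have "(smult \<alpha> u + smult \<beta> v) * F u v = (\<Sum>p\<le>Suc N. smult (d p) (u ^ p * v ^ (Suc N - p)))" for u v
  proof -
    have "smult \<alpha> u * F u v =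
        (\<Sum>p\<le>Suc N. smult (if p = 0 then 0 else \<alpha> * c (p - 1)) (u ^ p * v ^ (Suc N - p)))"
      unfolding c sum.atMost_Suc_shift by (simp add: sum_distrib_left mult_ac)
    moreover have "smult \<beta> v * F u v =
        (\<Sum>p\<le>Suc N. smult (if p \<le> N then \<beta> * c p else 0) (u ^ p * v ^ (Suc N - p)))"
      unfolding c sum.atMost_Suc
      by (auto simp: sum_distrib_left mult_ac Suc_diff_le intro!: sum.cong)
    ultimately show ?thesis
      by (simp add: distrib_right d_def smult_add_left sum.distrib)
  qed
  then show ?thesis unfolding homogeneous_def by blast
qed

lemma homogeneous_linear_powers:
  "homogeneous (m + n) (\<lambda>u v. (smult \<alpha> u + smult \<beta> v) ^ m * (smult \<gamma> u + smult \<delta> v) ^ n)"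
proof (induction m)
  case 0
  show ?case
  proof (induction n)
    case 0
    show ?case unfolding homogeneous_def by (rule exI[of _ "\<lambda>_. 1"]) simp
  next
    case (Suc n)
    from homogeneous_mult_linear[OF this, of \<gamma> \<delta>] show ?case by (simp add: mult_ac)
  qed
next
  case (Suc m)
  from homogeneous_mult_linear[OF this, of \<alpha> \<beta>] show ?case by (simp add: mult_ac)
qed

text \<open>
  The spin-\<open>S/2\<close> representation acts on polynomials of degree at most \<open>S\<close> (binary forms of degree
  \<open>S\<close>, dehomogenized), with \<open>y\<^sup>a\<close> corresponding to the basis vector of index \<open>a\<close> divided by
  \<open>sqrt (S choose a)\<close>. There \<open>2 \<i> S\<^sup>y\<close> is \<open>f \<mapsto> (1 + y\<^sup>2) f' - S y f\<close>, and the polynomials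
  \<open>rotor S p\<close> are its eigenvectors.
\<close>

definition rotor :: "nat \<Rightarrow> nat \<Rightarrow> complex poly" where
  "rotor S p = [:1, \<i>:] ^ p * [:1, - \<i>:] ^ (S - p)"

definition spin_vec :: "nat \<Rightarrow> complex poly \<Rightarrow> complex vec" where
  "spin_vec S f = vec (S + 1) (\<lambda>a. coeff f a / complex_of_real (sqrt (real (S choose a))))"

text \<open>With \<open>u = 1 + \<i> y\<close> and \<open>v = 1 - \<i> y\<close> one has
  \<open>1 + y^2 = u * v\<close>, so differentiating \<open>u ^ p * v ^ (S - p)\<close> and
  multiplying by \<open>u * v\<close> gives back the same product times a linear polynomial, whose
  \<open>y\<close> part is cancelled by the term with \<open>S\<close>.\<close>

lemma rotor_pderiv:
  assumes "p \<le> S"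
  shows "[:1, 0, 1:] * pderiv (rotor S p) - smult (of_nat S) ([:0, 1:] * rotor S p) =
    smult (\<i> * (2 * of_nat p - of_nat S)) (rotor S p)"
proof -
  \<comment> \<open>Multiplying by \<open>q\<close> restores the full power and avoids a separate
    treatment of exponent 0.\<close>
  have pd: "q * pderiv (q ^ k) = of_nat k * pderiv q * q ^ k" for q :: "complex poly" and k
  proof (cases k)
    case (Suc l)
    show ?thesis
      unfolding Suc pderiv_power_Suc by (simp add: mult_ac of_nat_poly del: of_nat_Suc)
  qed simp
  let ?u = "[:1, \<i>:]" and ?v = "[:1, - \<i>:]"
  have "[:1, 0, 1:] = ?u * ?v" by simp
  then have "[:1, 0, 1:] * pderiv (rotor S p) =
      (?u * pderiv (?u ^ p)) * (?v * ?v ^ (S - p)) + (?u * ?u ^ p) * (?v * pderiv (?v ^ (S - p)))"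
    unfolding rotor_def by (simp only: pderiv_mult) (simp only: algebra_simps)
  also have "\<dots> = (of_nat p * pderiv ?u * ?v + of_nat (S - p) * pderiv ?v * ?u) * rotor S p"
    unfolding pd rotor_def by (simp only: algebra_simps)
  also have "of_nat p * pderiv ?u * ?v + of_nat (S - p) * pderiv ?v * ?u =
      smult (of_nat S) [:0, 1:] + [:\<i> * (2 * of_nat p - of_nat S):]"
    using assms by (simp add: pderiv_pCons of_nat_poly of_nat_diff algebra_simps)
  finally show ?thesis by (simp add: distrib_right)
qed

lemma degree_rotor: "p \<le> S \<Longrightarrow> degree (rotor S p) \<le> S"
proof -
  assume "p \<le> S"
  have "degree ([:1, \<i>:] ^ p) \<le> p" "degree ([:1, - \<i>:] ^ (S - p)) \<le> S - p"
    using degree_power_le[of "[:1, \<i>:]" p] degree_power_le[of "[:1, - \<i>:]" "S - p"] by simp_all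
  then show ?thesis
    using degree_mult_le[of "[:1, \<i>:] ^ p" "[:1, - \<i>:] ^ (S - p)"] \<open>p \<le> S\<close> unfolding rotor_def by linarith
qed

text \<open>Both parts rest on \<open>(a + 1) * (S choose (a + 1)) = (S - a) * (S choose a)\<close>.
  They turn the square roots in the spin matrix elements into the integer coefficients produced by
  differentiation.\<close>

lemma binomial_sqrt_Suc:
  assumes "a < S"
  shows "sqrt (real (Suc a * (S - a))) / sqrt (real (S choose Suc a)) = real (Suc a) / sqrt (real (S choose a))"
    and "sqrt (real (Suc a * (S - a))) / sqrt (real (S choose a)) = real (S - a) / sqrt (real (S choose Suc a))"
proof -
  have eq: "real (Suc a) * real (S choose Suc a) = real (S - a) * real (S choose a)"
    using binomial_absorb_comp[of S a] Suc_times_binomial_eq[of "S - 1" a] assms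
    by (metis Suc_times_binomial_add of_nat_mult binomial_absorption mult.commute)
  have pos: "real (S choose Suc a) > 0" "real (S choose a) > 0" "real (S - a) > 0" using assms by auto
  have "real (Suc a * (S - a)) * real (S choose a) = (real (Suc a))\<^sup>2 * real (S choose Suc a)"
    using arg_cong[OF eq, of "(*) (real (Suc a))"]
    by (simp add: power2_eq_square mult_ac del: of_nat_Suc mult_Suc mult_Suc_right)
  then have "sqrt (real (Suc a * (S - a))) * sqrt (real (S choose a)) = real (Suc a) * sqrt (real (S choose Suc a))"
    by (metis abs_of_nat real_sqrt_abs real_sqrt_mult)
  then show "sqrt (real (Suc a * (S - a))) / sqrt (real (S choose Suc a)) = real (Suc a) / sqrt (real (S choose a))"
    using pos by (simp add: field_simps)
  have "real (Suc a * (S - a)) * real (S choose Suc a) = (real (S - a))\<^sup>2 * real (S choose a)"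
    using arg_cong[OF eq, of "(*) (real (S - a))"]
    by (simp add: power2_eq_square mult_ac del: of_nat_Suc mult_Suc mult_Suc_right)
  then have "sqrt (real (Suc a * (S - a))) * sqrt (real (S choose Suc a)) = real (S - a) * sqrt (real (S choose a))"
    by (metis abs_of_nat real_sqrt_abs real_sqrt_mult)
  then show "sqrt (real (Suc a * (S - a))) / sqrt (real (S choose a)) = real (S - a) / sqrt (real (S choose Suc a))"
    using pos by (simp add: field_simps)
qed


section \<open>Exponentiating the spin generator\<close>

definition spin_gen :: "nat \<Rightarrow> complex mat" where
  "spin_gen S = (\<i> * complex_of_real pi) \<cdot>\<^sub>m aux_Sy S"

lemma spin_gen_carrier: "spin_gen S \<in> carrier_mat (S + 1) (S + 1)"
  by (simp add: spin_gen_def aux_Sy_def)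

lemma coeff_diff_operator:
  fixes f :: "complex poly"
  shows "coeff ([:1, 0, 1:] * pderiv f - smult (of_nat S) ([:0, 1:] * f)) a =
    of_nat (Suc a) * coeff f (Suc a) - (if a = 0 then 0 else (of_nat S - of_nat (a - 1)) * coeff f (a - 1))"
proof -
  have "[:1, 0, 1:] * pderiv f = pderiv f + pCons 0 (pCons 0 (pderiv f))" by simp
  then show ?thesis
    by (cases a; cases "a - 1") (auto simp: coeff_pderiv algebra_simps)
qed

text \<open>\<open>spin_vec\<close> intertwines the matrix with the differential operator. In the
  last row the matrix is cut off, which agrees with the operator because the degree bound makes
  coefficient \<open>S + 1\<close> vanish.\<close>

lemma spin_gen_mult_spin_vec:
  assumes "degree f \<le> S"
  shows "spin_gen S *\<^sub>v spin_vec S f =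
    (complex_of_real pi / 2) \<cdot>\<^sub>v spin_vec S ([:1, 0, 1:] * pderiv f - smult (of_nat S) ([:0, 1:] * f))"
proof (rule eq_vecI)
  let ?g = "\<lambda>a. complex_of_real (sqrt (real (S choose a)))"
  let ?D = "[:1, 0, 1:] * pderiv f - smult (of_nat S) ([:0, 1:] * f)"
  fix a assume "a < dim_vec ((complex_of_real pi / 2) \<cdot>\<^sub>v spin_vec S ?D)"
  then have a: "a \<le> S" by (simp add: spin_vec_def)
  define x where "x b = coeff f b / ?g b" for b
  have "(spin_gen S *\<^sub>v spin_vec S f) $ a = (\<Sum>b\<in>{0..<S+1}. spin_gen S $$ (a, b) * x b)"
    using a carrier_matD[OF spin_gen_carrier[of S]]
    by (simp add: scalar_prod_def spin_vec_def x_def)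
  also have "\<dots> = complex_of_real pi / 2 *
      (\<Sum>b\<in>{0..<S+1}. (if b = Suc a then complex_of_real (sqrt (real (Suc a * (S - a)))) * x (Suc a) else 0)
       - (if a = Suc b then complex_of_real (sqrt (real (Suc b * (S - b)))) * x b else 0))"
    unfolding sum_distrib_left
    by (rule sum.cong[OF refl])
      (use a in \<open>auto simp: spin_gen_def aux_Sy_index simp del: of_nat_mult of_nat_Suc mult_Suc\<close>)
  also have "(\<Sum>b\<in>{0..<S+1}. (if b = Suc a then complex_of_real (sqrt (real (Suc a * (S - a)))) * x (Suc a) else 0)
       - (if a = Suc b then complex_of_real (sqrt (real (Suc b * (S - b)))) * x b else 0)) =
      (if a < S then complex_of_real (sqrt (real (Suc a * (S - a)))) * x (Suc a) else 0)
      - (if a = 0 then 0 else complex_of_real (sqrt (real (a * (S - (a - 1))))) * x (a - 1))"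
  proof -
    have "(\<Sum>b\<in>{0..<S+1}. if a = Suc b then complex_of_real (sqrt (real (Suc b * (S - b)))) * x b else 0) =
        (if a = 0 then 0 else complex_of_real (sqrt (real (a * (S - (a - 1))))) * x (a - 1))"
    proof (cases a)
      case (Suc k)
      then show ?thesis using a by (simp add: sum.delta' del: of_nat_mult of_nat_Suc mult_Suc)
    qed simp
    then show ?thesis using a by (simp add: sum_subtractf del: of_nat_mult of_nat_Suc mult_Suc)
  qed
  also have "(if a < S then complex_of_real (sqrt (real (Suc a * (S - a)))) * x (Suc a) else 0) =
      of_nat (Suc a) * coeff f (Suc a) / ?g a"
  proof (cases "a < S")
    case True
    have "complex_of_real (sqrt (real (Suc a * (S - a)))) * x (Suc a) =
        complex_of_real (sqrt (real (Suc a * (S - a))) / sqrt (real (S choose Suc a))) * coeff f (Suc a)"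
      by (simp add: x_def del: of_nat_mult of_nat_Suc mult_Suc)
    then show ?thesis
      using True unfolding binomial_sqrt_Suc(1)[OF True] by (simp del: of_nat_Suc)
  next
    case False
    then show ?thesis using assms a by (simp add: coeff_eq_0)
  qed
  also have "(if a = 0 then 0 else complex_of_real (sqrt (real (a * (S - (a - 1))))) * x (a - 1)) =
      (if a = 0 then 0 else (of_nat S - of_nat (a - 1)) * coeff f (a - 1)) / ?g a"
  proof (cases a)
    case (Suc k)
    then have k: "k < S" using a by simp
    have "complex_of_real (sqrt (real (Suc k * (S - k)))) * x k =
        complex_of_real (sqrt (real (Suc k * (S - k))) / sqrt (real (S choose k))) * coeff f k"
      by (simp add: x_def del: of_nat_mult of_nat_Suc mult_Suc)
    then show ?thesis
      using Suc k unfolding binomial_sqrt_Suc(2)[OF k] by (simp add: of_nat_diff del: of_nat_mult mult_Suc)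
  qed simp
  also have "complex_of_real pi / 2 * (of_nat (Suc a) * coeff f (Suc a) / ?g a -
      (if a = 0 then 0 else (of_nat S - of_nat (a - 1)) * coeff f (a - 1)) / ?g a) =
      ((complex_of_real pi / 2) \<cdot>\<^sub>v spin_vec S ?D) $ a"
    using a by (simp only: spin_vec_def index_smult_vec coeff_diff_operator dim_vec index_vec
        less_Suc_eq_le Suc_eq_plus1[symmetric] diff_divide_distrib)
  finally show "(spin_gen S *\<^sub>v spin_vec S f) $ a = ((complex_of_real pi / 2) \<cdot>\<^sub>v spin_vec S ?D) $ a" .
qed (simp add: spin_vec_def carrier_matD(1)[OF spin_gen_carrier])

lemma spin_gen_pow_mult_rotor:
  assumes "p \<le> S"
  shows "spin_gen S ^\<^sub>m k *\<^sub>v spin_vec S (rotor S p) =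
    (\<i> * complex_of_real pi * (2 * of_nat p - of_nat S) / 2) ^ k \<cdot>\<^sub>v spin_vec S (rotor S p)"
proof (induction k)
  case 0
  have "spin_vec S (rotor S p) \<in> carrier_vec (S + 1)" by (simp add: spin_vec_def)
  then show ?case using carrier_matD(1)[OF spin_gen_carrier[of S]] by simp
next
  case (Suc k)
  let ?w = "spin_vec S (rotor S p)" and ?l = "\<i> * complex_of_real pi * (2 * of_nat p - of_nat S) / 2"
  have w: "?w \<in> carrier_vec (S + 1)" by (simp add: spin_vec_def)
  have P: "spin_gen S ^\<^sub>m k \<in> carrier_mat (S + 1) (S + 1)" by (rule pow_carrier_mat[OF spin_gen_carrier])
  have "spin_gen S *\<^sub>v ?w = ?l \<cdot>\<^sub>v ?w"
    unfolding spin_gen_mult_spin_vec[OF degree_rotor[OF assms]] rotor_pderiv[OF assms]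
    by (intro eq_vecI) (auto simp: spin_vec_def)
  then have "spin_gen S ^\<^sub>m Suc k *\<^sub>v ?w = spin_gen S ^\<^sub>m k *\<^sub>v (?l \<cdot>\<^sub>v ?w)"
    using assoc_mult_mat_vec[OF P spin_gen_carrier w] by simp
  also have "\<dots> = ?l \<cdot>\<^sub>v (?l ^ k \<cdot>\<^sub>v ?w)"
    unfolding mult_mat_vec[OF P w] Suc.IH ..
  finally show ?case by (simp add: smult_smult_assoc)
qed

text \<open>With \<open>u = 1 + \<i> y\<close> and \<open>v = 1 - \<i> y\<close>,
  \<open>1 = (u + v) / 2\<close> and \<open>y = (u - v) / (2 * \<i>)\<close>. Replacing
  \<open>u\<close> by \<open>\<i> u\<close> and \<open>v\<close> by \<open>- \<i> v\<close> sends 1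
  to \<open>- y\<close> and \<open>y\<close> to 1, so the same coefficients, weighted by the
  quarter-turn factors, expand the image of \<open>y^b\<close> under the rotation.\<close>

lemma rotor_expansion:
  assumes "b \<le> S"
  obtains c where "monom 1 b = (\<Sum>p\<le>S. smult (c p) (rotor S p))"
    "monom ((-1) ^ (S - b)) (S - b) = (\<Sum>p\<le>S. smult (c p * (\<i> ^ p * (- \<i>) ^ (S - p))) (rotor S p))"
proof -
  obtain c where c: "(smult (1/2) u + smult (1/2) v) ^ (S - b) *
      (smult (1 / (2 * \<i>)) u + smult (- 1 / (2 * \<i>)) v) ^ b =
      (\<Sum>p\<le>S. smult (c p) (u ^ p * v ^ (S - p)))" for u v
    using homogeneous_linear_powers[of "S - b" b "1/2" "1/2" "1 / (2 * \<i>)" "- 1 / (2 * \<i>)"] assms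
    unfolding homogeneous_def by auto
  show ?thesis
  proof
    have "monom 1 b = (smult (1/2) [:1, \<i>:] + smult (1/2) [:1, - \<i>:]) ^ (S - b) *
      (smult (1 / (2 * \<i>)) [:1, \<i>:] + smult (- 1 / (2 * \<i>)) [:1, - \<i>:]) ^ b"
      by (simp add: monom_altdef flip: one_pCons)
    then show "monom 1 b = (\<Sum>p\<le>S. smult (c p) (rotor S p))"
      unfolding c by (simp add: rotor_def)
    have "monom ((-1) ^ (S - b)) (S - b) = [:0, -1:] ^ (S - b) * (1 :: complex poly) ^ b"
      by (simp add: monom_altdef flip: smult_power)
    also have "[:0, -1:] = smult (1/2) (smult \<i> [:1, \<i>:]) + smult (1/2) (smult (- \<i>) [:1, - \<i>:])"
      by simp
    also have "1 = smult (1 / (2 * \<i>)) (smult \<i> [:1, \<i>:]) + smult (- 1 / (2 * \<i>)) (smult (- \<i>) [:1, - \<i>:])"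
      by (simp flip: one_pCons)
    finally show "monom ((-1) ^ (S - b)) (S - b) =
        (\<Sum>p\<le>S. smult (c p * (\<i> ^ p * (- \<i>) ^ (S - p))) (rotor S p))"
      unfolding c rotor_def
      by (simp only: smult_power mult_smult_left mult_smult_right smult_smult mult_ac)
  qed
qed

lemma exp_quarter_turns:
  assumes "p \<le> S"
  shows "exp (\<i> * complex_of_real pi * (2 * of_nat p - of_nat S) / 2) = \<i> ^ p * (- \<i>) ^ (S - p)"
proof -
  have "exp (\<i> * complex_of_real pi * (2 * of_nat p - of_nat S) / 2) =
      exp (of_nat p * (\<i> * complex_of_real pi / 2)) * exp (of_nat (S - p) * (- (\<i> * complex_of_real pi / 2)))"
    unfolding exp_add[symmetric] using assms by (simp add: of_nat_diff field_simps)
  also have "exp (\<i> * complex_of_real pi / 2) = \<i>"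
    using cis_pi_half by (simp add: cis_conv_exp)
  then have "exp (of_nat p * (\<i> * complex_of_real pi / 2)) * exp (of_nat (S - p) * (- (\<i> * complex_of_real pi / 2)))
     = \<i> ^ p * (- \<i>) ^ (S - p)"
    unfolding exp_of_nat_mult exp_minus by simp
  finally show ?thesis .
qed

lemma exp_sums_divide_fact: "(\<lambda>k. z ^ k / fact k) sums exp (z::complex)"
  using exp_converges[of z] by (simp add: scaleR_conv_of_real divide_inverse mult.commute)

text \<open>The basis vector of index \<open>b\<close> is expanded in eigenvectors of the generator,
  the exponential acts on the eigenvalues, and the resulting quarter-turn factors recombine into a
  single monomial.\<close>

lemma U_I_index:
  assumes a: "a \<le> S" and b: "b \<le> S"
  shows "U_I S $$ (a, b) = (if a + b = S then (-1) ^ a else 0)"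
proof -
  let ?g = "\<lambda>a. complex_of_real (sqrt (real (S choose a)))"
  let ?l = "\<lambda>p. \<i> * complex_of_real pi * (2 * of_nat p - of_nat S) / 2"
  obtain c where c: "monom 1 b = (\<Sum>p\<le>S. smult (c p) (rotor S p))"
    and c': "monom ((-1) ^ (S - b)) (S - b) =
      (\<Sum>p\<le>S. smult (c p * (\<i> ^ p * (- \<i>) ^ (S - p))) (rotor S p))"
    using rotor_expansion[OF b] by blast
  have g: "?g b \<noteq> 0" using b by simp
  have pow: "(spin_gen S ^\<^sub>m k) $$ (a, b) =
      (\<Sum>p\<le>S. ?g b * c p * coeff (rotor S p) a / ?g a * ?l p ^ k)" for k
  proof -
    have P: "spin_gen S ^\<^sub>m k \<in> carrier_mat (S + 1) (S + 1)" by (rule pow_carrier_mat[OF spin_gen_carrier])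
    \<comment> \<open>The unit vector of index \<open>b\<close> as a combination of the
      eigenvectors; the factor \<open>?g b\<close> undoes the normalization in
      \<open>spin_vec\<close>.\<close>
    have unit: "(\<Sum>p\<le>S. ?g b * c p * coeff (rotor S p) j / ?g j) = (if j = b then 1 else 0)" for j
    proof -
      have "(\<Sum>p\<le>S. ?g b * c p * coeff (rotor S p) j / ?g j) = ?g b * coeff (monom 1 b) j / ?g j"
        unfolding c coeff_sum by (simp add: sum_distrib_left sum_divide_distrib mult_ac)
      then show ?thesis using g by simp
    qed
    have "(spin_gen S ^\<^sub>m k) $$ (a, b) = (\<Sum>j\<in>{0..<S+1}. (spin_gen S ^\<^sub>m k) $$ (a, j) *
        (\<Sum>p\<le>S. ?g b * c p * coeff (rotor S p) j / ?g j))"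
      unfolding unit using b by (simp add: if_distrib cong: if_cong del: sum.op_ivl_Suc)
    also have "\<dots> = (\<Sum>p\<le>S. ?g b * c p *
        (\<Sum>j\<in>{0..<S+1}. (spin_gen S ^\<^sub>m k) $$ (a, j) * (coeff (rotor S p) j / ?g j)))"
      unfolding sum_distrib_left by (subst sum.swap) (simp add: mult_ac)
    also have "\<dots> = (\<Sum>p\<le>S. ?g b * c p * (?l p ^ k * (coeff (rotor S p) a / ?g a)))"
    proof (rule sum.cong[OF refl])
      fix p assume "p \<in> {..S}"
      then have p: "p \<le> S" by simp
      have "(\<Sum>j\<in>{0..<S+1}. (spin_gen S ^\<^sub>m k) $$ (a, j) * (coeff (rotor S p) j / ?g j)) =
          (spin_gen S ^\<^sub>m k *\<^sub>v spin_vec S (rotor S p)) $ a"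
        using a carrier_matD[OF P] by (simp add: scalar_prod_def spin_vec_def)
      also have "\<dots> = ?l p ^ k * (coeff (rotor S p) a / ?g a)"
        unfolding spin_gen_pow_mult_rotor[OF p] using a by (simp add: spin_vec_def)
      finally show "?g b * c p *
          (\<Sum>j\<in>{0..<S+1}. (spin_gen S ^\<^sub>m k) $$ (a, j) * (coeff (rotor S p) j / ?g j)) =
          ?g b * c p * (?l p ^ k * (coeff (rotor S p) a / ?g a))" by simp
    qed
    finally show ?thesis by (simp add: mult_ac)
  qed
  have sums: "(\<lambda>k. (spin_gen S ^\<^sub>m k) $$ (a, b) / fact k) sums
      (\<Sum>p\<le>S. ?g b * c p * coeff (rotor S p) a / ?g a * exp (?l p))"
    unfolding pow sum_divide_distrib
  proof (rule sums_sum)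
    fix p
    from sums_mult[OF exp_sums_divide_fact[of "?l p"], of "?g b * c p * coeff (rotor S p) a / ?g a"]
    show "(\<lambda>k. ?g b * c p * coeff (rotor S p) a / ?g a * ?l p ^ k / fact k) sums
        (?g b * c p * coeff (rotor S p) a / ?g a * exp (?l p))" by (simp only: times_divide_eq_right)
  qed
  have "U_I S $$ (a, b) = (\<Sum>p\<le>S. ?g b * c p * coeff (rotor S p) a / ?g a * exp (?l p))"
    using a b carrier_matD[OF spin_gen_carrier[of S]]
    unfolding U_I_def mat_exp_def spin_gen_def[symmetric] sums_unique[OF sums] by simp
  also have "\<dots> = ?g b / ?g a * coeff (monom ((-1) ^ (S - b)) (S - b)) a"
    unfolding c' coeff_sum sum_distrib_left
    by (rule sum.cong) (auto simp: exp_quarter_turns)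
  \<comment> \<open>For \<open>a + b = S\<close> the two binomial coefficients agree, so the
    normalizations cancel, and \<open>S - b = a\<close>.\<close>
  also have "\<dots> = (if a + b = S then (-1) ^ a else 0)"
    using g b binomial_symmetric[OF b] by (auto simp: coeff_monom)
  finally show ?thesis .
qed

section \<open>Reversal of AKLT states\<close>

lemma rfact_of_nat [simp]: "rfact (real n) = fact n"
  by (simp add: rfact_def)

lemma rfact_0 [simp]: "rfact 0 = 1"
  by (simp add: rfact_def)

lemma clebsch_gordan_eq_0:
  "\<not> (M = m1 + m2 \<and> \<bar>m1\<bar> \<le> j1 \<and> \<bar>m2\<bar> \<le> j2) \<Longrightarrow> clebsch_gordan j1 m1 j2 m2 J M = 0"
  unfolding clebsch_gordan_def by (rule if_not_P) blast

text \<open>For total spin \<open>2 * j\<close> the bound \<open>k \<le> j1 + j2 - J\<close> leaves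
  only \<open>k = 0\<close> in Racah's sum. The closed form is visibly symmetric in \<open>x\<close>
  and \<open>y\<close>.\<close>

lemma clebsch_gordan_maximal:
  assumes "\<bar>x\<bar> \<le> j" "\<bar>y\<bar> \<le> j"
  shows "clebsch_gordan j x j y (2 * j) (x + y) =
    sqrt ((4 * j + 1) * rfact (2 * j) * rfact (2 * j) / rfact (4 * j + 1))
    * sqrt (rfact (2 * j + (x + y)) * rfact (2 * j - (x + y)) * rfact (j - x) * rfact (j + x)
        * rfact (j - y) * rfact (j + y))
    / (rfact (j - x) * rfact (j + x) * rfact (j - y) * rfact (j + y))"
proof -
  have cond: "x + y = x + y \<and> \<bar>j - j\<bar> \<le> 2 * j \<and> 2 * j \<le> j + j \<and> \<bar>x\<bar> \<le> j \<and> \<bar>y\<bar> \<le> j \<and>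
      \<bar>x + y\<bar> \<le> 2 * j"
    using assms by linarith
  have K: "{k. real k \<le> j + j - 2 * j \<and> real k \<le> j - x \<and> real k \<le> j + y \<and>
      0 \<le> 2 * j - j + x + real k \<and> 0 \<le> 2 * j - j - y + real k} = {0}"
    using assms by auto
  have e: "2 * (2 * j) + 1 = 4 * j + 1" "2 * j + j - j = 2 * j" "2 * j - j + j = 2 * j"
    "j + j - 2 * j = 0" "j + j + 2 * j + 1 = 4 * j + 1" "2 * j - j + x = j + x" "2 * j - j - y = j - y"
    by simp_all
  show ?thesis
    unfolding clebsch_gordan_def if_P[OF cond] K unfolding e by (simp add: mult_ac)
qed

lemma clebsch_gordan_maximal_commute:
  "clebsch_gordan j x j y (2 * j) M = clebsch_gordan j y j x (2 * j) M"
proof (cases "M = x + y \<and> \<bar>x\<bar> \<le> j \<and> \<bar>y\<bar> \<le> j")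
  case True
  then have M: "M = x + y" "M = y + x" and xy: "\<bar>x\<bar> \<le> j" "\<bar>y\<bar> \<le> j" by auto
  have "clebsch_gordan j x j y (2 * j) (x + y) = clebsch_gordan j y j x (2 * j) (y + x)"
    unfolding clebsch_gordan_maximal[OF xy] clebsch_gordan_maximal[OF xy(2,1)]
    by (simp only: mult_ac add.commute[of y x])
  then show ?thesis by (simp only: M[symmetric])
next
  case False
  then have "\<not> (M = y + x \<and> \<bar>y\<bar> \<le> j \<and> \<bar>x\<bar> \<le> j)" by auto
  with False show ?thesis using clebsch_gordan_eq_0 by metis
qed

text \<open>For total spin 0 and opposite projections, the bounds in Racah's sum squeeze
  \<open>k\<close> to the single value \<open>a\<close>, which produces the sign.\<close>

lemma clebsch_gordan_singlet:
  assumes "a \<le> S" "b \<le> S"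
  shows "clebsch_gordan (real S / 2) (aux_m S a) (real S / 2) (aux_m S b) 0 0 =
    (if a + b = S then (-1) ^ a / sqrt (real S + 1) else 0)"
proof (cases "a + b = S")
  case False
  then have "aux_m S a + aux_m S b \<noteq> 0" by (auto simp: aux_m_def)
  then show ?thesis using False by (simp add: clebsch_gordan_def)
next
  case True
  then have m: "aux_m S a + aux_m S b = 0" "\<bar>aux_m S a\<bar> \<le> real S / 2" "\<bar>aux_m S b\<bar> \<le> real S / 2"
    by (auto simp: aux_m_def)
  \<comment> \<open>Factorial arguments are written as \<open>real\<close> of a natural number so
    that \<open>rfact_of_nat\<close> applies.\<close>
  have e: "real S / 2 - aux_m S a = real a" "real S / 2 + aux_m S a = real b"
    "real S / 2 - aux_m S b = real b" "real S / 2 + aux_m S b = real a"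
    "0 - real S / 2 + aux_m S a = - real a" "0 - real S / 2 - aux_m S b = - real a"
    "real S / 2 + real S / 2 - 0 = real S"
    "0 + real S / 2 - real S / 2 = real 0" "0 - real S / 2 + real S / 2 = real 0"
    "real S / 2 + real S / 2 + 0 + 1 = real (Suc S)"
    "(0::real) + 0 = real 0" "(0::real) - 0 = real 0"
    using True by (auto simp: aux_m_def)
  have K: "{k. real k \<le> real S \<and> real k \<le> real a \<and> real k \<le> real a \<and>
      0 \<le> - real a + real k \<and> 0 \<le> - real a + real k} = {a}"
    using assms by auto
  have d: "real S - real a = real b" "real a - real a = real 0" "- real a + real a = real 0"
    using True by auto
  have "clebsch_gordan (real S / 2) (aux_m S a) (real S / 2) (aux_m S b) 0 0 =
     sqrt (fact S / fact (Suc S)) * sqrt (fact a * fact b * fact b * fact a) *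
     ((-1) ^ a / (fact a * fact b))"
    unfolding clebsch_gordan_def e K using m
    by (simp add: d del: fact_Suc of_nat_Suc of_nat_0)
  also have "sqrt (fact a * fact b * fact b * fact a) = fact a * (fact b :: real)"
    by (rule real_sqrt_unique) (auto simp: power2_eq_square)
  also have "fact (Suc S) = (real S + 1) * fact S"
    by (simp add: add.commute)
  finally show ?thesis using True by (simp add: real_sqrt_divide real_sqrt_mult)
qed

section \<open>Matrix product amplitudes under reversal\<close>

lemma aklt_M_carrier: "aklt_M S m \<in> carrier_mat (S + 1) (S + 1)"
  and aklt_Theta_carrier: "aklt_Theta S \<in> carrier_mat (S + 1) (S + 1)"
  and aklt_A_carrier: "aklt_A S m \<in> carrier_mat (S + 1) (S + 1)"
  by (auto simp: aklt_M_def aklt_Theta_def aklt_A_def)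

lemma transpose_aklt_M: "transpose_mat (aklt_M S m) = aklt_M S m"
  using clebsch_gordan_maximal_commute[of "real S / 2"]
  by (intro eq_matI) (auto simp: aklt_M_def)

lemma aklt_Theta_index:
  assumes "a \<le> S" "b \<le> S"
  shows "aklt_Theta S $$ (a, b) = (if a + b = S then (-1) ^ a / complex_of_real (sqrt (real S + 1)) else 0)"
  using assms by (simp add: aklt_Theta_def clebsch_gordan_singlet)

text \<open>On the antidiagonal \<open>a + b = S\<close>, the signs \<open>(-1) ^ a\<close> and
  \<open>(-1) ^ b\<close> differ by the factor \<open>(-1) ^ S\<close>.\<close>

lemma transpose_aklt_Theta: "transpose_mat (aklt_Theta S) = (-1) ^ S \<cdot>\<^sub>m aklt_Theta S"
proof (rule eq_matI)
  fix a b assume "a < dim_row ((-1) ^ S \<cdot>\<^sub>m aklt_Theta S)" "b < dim_col ((-1) ^ S \<cdot>\<^sub>m aklt_Theta S)"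
  then have ab: "a \<le> S" "b \<le> S" by (auto simp: aklt_Theta_def)
  then have "transpose_mat (aklt_Theta S) $$ (a, b) = aklt_Theta S $$ (b, a)"
    by (simp add: aklt_Theta_def)
  also have "\<dots> = (-1) ^ S * aklt_Theta S $$ (a, b)"
    using ab by (auto simp: aklt_Theta_index power_add mult.assoc[symmetric] simp flip: power_mult_distrib)
  finally show "transpose_mat (aklt_Theta S) $$ (a, b) = ((-1) ^ S \<cdot>\<^sub>m aklt_Theta S) $$ (a, b)"
    using ab by (simp add: aklt_Theta_def)
qed (auto simp: aklt_Theta_def)

definition aklt_product :: "nat \<Rightarrow> int list \<Rightarrow> complex mat" where
  "aklt_product S ms = foldr (\<lambda>m X. aklt_A S m * X) ms (1\<^sub>m (S + 1))"

lemma aklt_product_Nil: "aklt_product S [] = 1\<^sub>m (S + 1)"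
  and aklt_product_Cons: "aklt_product S (m # ms) = aklt_A S m * aklt_product S ms"
  by (simp_all add: aklt_product_def)

lemma aklt_product_carrier: "aklt_product S ms \<in> carrier_mat (S + 1) (S + 1)"
proof (induction ms)
  case (Cons m ms)
  show ?case unfolding aklt_product_Cons by (rule mult_carrier_mat[OF aklt_A_carrier Cons.IH])
qed (simp add: aklt_product_Nil)

lemma aklt_product_snoc: "aklt_product S (ms @ [m]) = aklt_product S ms * aklt_A S m"
proof (induction ms)
  case Nil
  show ?case
    using aklt_A_carrier[of S m] by (simp add: aklt_product_Nil aklt_product_Cons)
next
  case (Cons k ms)
  then show ?case
    using assoc_mult_mat[OF aklt_A_carrier[of S k] aklt_product_carrier[of S ms] aklt_A_carrier[of S m]]
    by (simp add: aklt_product_Cons)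
qed

text \<open>With \<open>\<Theta>\<close> in front, the product is a word
  \<open>\<Theta> M \<Theta> M ... \<Theta>\<close> that begins and ends with
  \<open>\<Theta>\<close>. Transposition reverses the order of the symmetric factors
  \<open>M\<close>, and each of the \<open>length ms + 1\<close> factors \<open>\<Theta>\<close>
  contributes \<open>(-1) ^ S\<close>.\<close>

lemma transpose_Theta_aklt_product:
  "transpose_mat (aklt_Theta S * aklt_product S ms) =
     ((-1) ^ (S * (length ms + 1))) \<cdot>\<^sub>m (aklt_Theta S * aklt_product S (rev ms))"
proof (induction ms)
  case Nil
  show ?case
    using aklt_Theta_carrier[of S] by (simp add: aklt_product_Nil transpose_aklt_Theta)
next
  case (Cons m ms)
  let ?T = "aklt_Theta S" and ?M = "aklt_M S m" and ?P = "aklt_product S ms"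
    and ?R = "aklt_product S (rev ms)" and ?n = "S + 1"
  let ?s = "(-1) ^ (S * (length ms + 1)) :: complex"
  note c = aklt_Theta_carrier[of S] aklt_M_carrier[of S m] aklt_product_carrier[of S ms]
    aklt_product_carrier[of S "rev ms"]
  have TM: "?T * ?M \<in> carrier_mat ?n ?n" and TP: "?T * ?P \<in> carrier_mat ?n ?n"
    and TR: "?T * ?R \<in> carrier_mat ?n ?n" and MT: "?M * ?T \<in> carrier_mat ?n ?n"
    using mult_carrier_mat c by blast+
  have "?T * aklt_product S (m # ms) = ?T * ?M * (?T * ?P)"
    unfolding aklt_product_Cons aklt_A_def
    using assoc_mult_mat[OF c(2,1,3)] assoc_mult_mat[OF c(1,2) TP] by simp
  then have "transpose_mat (?T * aklt_product S (m # ms)) =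
      transpose_mat (?T * ?P) * (transpose_mat ?M * transpose_mat ?T)"
    using transpose_mult[OF TM TP] transpose_mult[OF c(1,2)] by simp
  also have "\<dots> = (?s \<cdot>\<^sub>m (?T * ?R)) * ((-1) ^ S \<cdot>\<^sub>m (?M * ?T))"
    unfolding Cons.IH transpose_aklt_M transpose_aklt_Theta mult_smult_distrib[OF c(2,1)] ..
  also have "\<dots> = ?s \<cdot>\<^sub>m ((-1) ^ S \<cdot>\<^sub>m (?T * ?R * (?M * ?T)))"
    unfolding mult_smult_assoc_mat[OF TR smult_carrier_mat[OF MT]] mult_smult_distrib[OF TR MT] ..
  also have "?T * ?R * (?M * ?T) = ?T * aklt_product S (rev (m # ms))"
    using assoc_mult_mat[OF c(1,4) MT] by (simp add: aklt_product_snoc aklt_A_def)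
  also have "?s \<cdot>\<^sub>m ((-1) ^ S \<cdot>\<^sub>m (?T * aklt_product S (rev (m # ms)))) =
      (-1) ^ (S * (length (m # ms) + 1)) \<cdot>\<^sub>m (?T * aklt_product S (rev (m # ms)))"
    by (intro eq_matI) (auto simp: power_add mult_ac)
  finally show ?case .
qed

text \<open>This choice of \<open>bl\<close> makes the amplitude a multiple of the quadratic form of
  \<open>\<Theta> A ... A\<close> at \<open>br\<close>, and a quadratic form does not change when
  its matrix is transposed.\<close>

lemma aklt_state_rev:
  assumes br: "br \<in> carrier_vec (S + 1)"
    and bl: "bl = c \<cdot>\<^sub>v (transpose_mat (aklt_Theta S) *\<^sub>v br)"
  shows "aklt_state S bl br (rev ms) = (-1) ^ (S * (length ms + 1)) * aklt_state S bl br ms"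
proof -
  let ?T = "aklt_Theta S"
  have TP: "?T * aklt_product S ks \<in> carrier_mat (S + 1) (S + 1)" for ks
    using mult_carrier_mat[OF aklt_Theta_carrier aklt_product_carrier] .
  have E: "aklt_state S bl br ks = c * (br \<bullet> ((?T * aklt_product S ks) *\<^sub>v br))" for ks
  proof -
    have "aklt_state S bl br ks =
        c * ((transpose_mat ?T *\<^sub>v br) \<bullet> (aklt_product S ks *\<^sub>v br))"
      unfolding aklt_state_def bl aklt_product_def[symmetric]
      using br aklt_Theta_carrier[of S] aklt_product_carrier[of S ks] by simp
    also have "(transpose_mat ?T *\<^sub>v br) \<bullet> (aklt_product S ks *\<^sub>v br) =
        br \<bullet> (?T *\<^sub>v (aklt_product S ks *\<^sub>v br))"
      by (rule transpose_vec_mult_scalar[OF aklt_Theta_carrier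
            mult_mat_vec_carrier[OF aklt_product_carrier br] br])
    also have "?T *\<^sub>v (aklt_product S ks *\<^sub>v br) = (?T * aklt_product S ks) *\<^sub>v br"
      by (rule assoc_mult_mat_vec[OF aklt_Theta_carrier aklt_product_carrier br, symmetric])
    finally show ?thesis .
  qed
  have "br \<bullet> ((?T * aklt_product S ms) *\<^sub>v br) =
      (transpose_mat (?T * aklt_product S ms) *\<^sub>v br) \<bullet> br"
    using transpose_vec_mult_scalar[OF TP br br] by simp
  also have "transpose_mat (?T * aklt_product S ms) *\<^sub>v br =
      (-1) ^ (S * (length ms + 1)) \<cdot>\<^sub>v ((?T * aklt_product S (rev ms)) *\<^sub>v br)"
    unfolding transpose_Theta_aklt_product using TP[of "rev ms"] br
    by (intro eq_vecI) auto
  also have "\<dots> \<bullet> br = (-1) ^ (S * (length ms + 1)) * (br \<bullet> ((?T * aklt_product S (rev ms)) *\<^sub>v br))"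
    unfolding smult_scalar_prod_distrib[OF mult_mat_vec_carrier[OF TP br] br]
      comm_scalar_prod[OF br mult_mat_vec_carrier[OF TP br]] ..
  finally show ?thesis
    unfolding E by (simp flip: power_mult_distrib mult.assoc)
qed

section \<open>Reversal of the tower and of the reduced density matrix\<close>

lemma site_raise_rev:
  assumes "\<And>ms. length ms = L \<Longrightarrow> \<phi> (rev ms) = s * \<psi> ms"
    and ms: "length ms = L" and j: "1 \<le> j" "j \<le> L"
  shows "site_raise S j \<phi> (rev ms) = s * site_raise S (L + 1 - j) \<psi> ms"
proof -
  have "rev ms ! (j - 1) = ms ! (L + 1 - j - 1)"
    using ms j by (simp add: rev_nth)
  moreover have "(rev ms)[j - 1 := m] = rev (ms[L + 1 - j - 1 := m])" for m
    using ms j by (simp add: rev_update)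
  ultimately show ?thesis
    using assms by (simp add: site_raise_def sum_distrib_left mult_ac)
qed

text \<open>The iterates on the two sides act on the mirror sites \<open>j\<close> and
  \<open>L + 1 - j\<close> and so are different states in general; hence
  \<open>site_raise_rev\<close> relates two states.\<close>

lemma site_raise_funpow_rev:
  assumes "\<And>ms. length ms = L \<Longrightarrow> \<phi> (rev ms) = s * \<psi> ms"
    and "1 \<le> j" "j \<le> L" and "length ms = L"
  shows "(site_raise S j ^^ k) \<phi> (rev ms) = s * (site_raise S (L + 1 - j) ^^ k) \<psi> ms"
  using assms(4)
proof (induction k arbitrary: ms)
  case 0
  then show ?case using assms(1) by simp
next
  case (Suc k)
  show ?case
    unfolding funpow.simps comp_def
    by (rule site_raise_rev) (use Suc assms(2,3) in auto)
qed

text \<open>For even \<open>L\<close> the mirror sites \<open>j\<close> and \<open>L + 1 - j\<close>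
  have opposite parity, so the staggered sign changes.\<close>

lemma tower_op_rev:
  assumes \<psi>: "\<And>ms. length ms = L \<Longrightarrow> \<psi> (rev ms) = s * \<psi> ms" and "even L" and ms: "length ms = L"
  shows "tower_op S L \<psi> (rev ms) = - s * tower_op S L \<psi> ms"
proof -
  let ?f = "\<lambda>j. (-1) ^ j * (site_raise S j ^^ (2 * S)) \<psi> ms"
  have "tower_op S L \<psi> (rev ms) = (\<Sum>j=1..L. - s * ?f (L + 1 - j))"
    unfolding tower_op_def
  proof (rule sum.cong[OF refl])
    fix j assume j: "j \<in> {1..L}"
    have "(-1) ^ (L + 1 - j) = (- ((-1) ^ j) :: complex)"
      using j \<open>even L\<close> by (auto simp: minus_one_power_iff)
    then show "(-1) ^ j * (site_raise S j ^^ (2 * S)) \<psi> (rev ms) = - s * ?f (L + 1 - j)"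
      using site_raise_funpow_rev[where S = S and k = "2 * S" and L = L and \<phi> = \<psi> and \<psi> = \<psi>
          and s = s and j = j and ms = ms, OF \<psi>] j ms
      by simp
  qed
  also have "\<dots> = - s * (\<Sum>j=1..L. ?f (L + 1 - j))"
    by (simp only: sum_distrib_left)
  also have "(\<Sum>j=1..L. ?f (L + 1 - j)) = (\<Sum>j=1..L. ?f j)"
    by (rule sum.reindex_bij_witness[of _ "\<lambda>j. L + 1 - j" "\<lambda>j. L + 1 - j"]) auto
  finally show ?thesis by (simp add: tower_op_def)
qed

text \<open>The ground state gives \<open>(-1) ^ (S * (L + 1))\<close>, which is
  \<open>(-1) ^ S\<close> for even \<open>L\<close>, and each of the \<open>N\<close> tower steps
  gives one more sign.\<close>

lemma tower_state_rev:
  assumes "br \<in> carrier_vec (S + 1)" and "bl = c \<cdot>\<^sub>v (transpose_mat (aklt_Theta S) *\<^sub>v br)"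
    and "even L" and "length ms = L"
  shows "tower_state S L N bl br (rev ms) = (-1) ^ (N + S) * tower_state S L N bl br ms"
  using assms(4)
proof (induction N arbitrary: ms)
  case 0
  then show ?case
    using aklt_state_rev[OF assms(1,2), of ms] \<open>even L\<close>
    by (simp add: tower_state_def power_add power_mult mult.commute[of S] )
next
  case (Suc N)
  then show ?case
    using tower_op_rev[of L "tower_state S L N bl br" "(-1) ^ (N + S)" ms S] \<open>even L\<close>
    by (simp add: tower_state_def)
qed

text \<open>The witness has entries \<open>\<psi> (a @ rev b)\<close> for half-chain configurations
  \<open>a\<close> and \<open>b\<close>. Reversing \<open>a @ rev b\<close> gives
  \<open>b @ rev a\<close>, which exchanges row and column.\<close>

lemma reduced_density_matrix_antisymmetric:
  assumes \<psi>: "\<And>ms. length ms = 2 * n \<Longrightarrow> \<psi> (rev ms) = - \<psi> ms"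
  obtains X where "X \<in> carrier_mat (length (configs S n)) (length (configs S n))"
    "\<And>a b. a < length (configs S n) \<Longrightarrow> b < length (configs S n) \<Longrightarrow> X $$ (b, a) = - X $$ (a, b)"
    "reduced_density_matrix S n n \<psi> = X * transpose_mat (map_mat cnj X)"
proof
  let ?C = "configs S n"
  let ?X = "mat (length ?C) (length ?C) (\<lambda>(a, b). \<psi> (?C ! a @ rev (?C ! b)))"
  show "?X \<in> carrier_mat (length ?C) (length ?C)" by simp
  have len: "length (?C ! a) = n" if "a < length ?C" for a
    using nth_mem[OF that] unfolding configs_def by (rule length_n_lists_elem)
  show "?X $$ (b, a) = - ?X $$ (a, b)" if "a < length ?C" "b < length ?C" for a b
    using \<psi>[of "?C ! a @ rev (?C ! b)"] len that by simp
  have dist: "distinct ?C" unfolding configs_def by (simp add: distinct_n_lists)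
  \<comment> \<open>Reversal permutes the half-chain configurations, so the partial trace may run
    over reversed ones and becomes a matrix product.\<close>
  have bij: "bij_betw (\<lambda>k. rev (?C ! k)) {0..<length ?C} (set ?C)"
  proof -
    have "bij_betw ((!) ?C) {0..<length ?C} (set ?C)"
      using bij_betw_nth[OF dist] by (simp add: atLeast0LessThan)
    moreover have "bij_betw rev (set ?C) (set ?C)"
      by (rule bij_betw_byWitness[of _ rev]) (auto simp: configs_def set_n_lists)
    ultimately show ?thesis by (rule bij_betw_trans[unfolded comp_def])
  qed
  show "reduced_density_matrix S n n \<psi> = ?X * transpose_mat (map_mat cnj ?X)"
    by (rule eq_matI)
      (auto simp: reduced_density_matrix_def scalar_prod_def sum.reindex_bij_betw[OF bij, symmetric])
qed

text \<open>\<open>U_I\<close> and \<open>\<Theta>\<close> have the same antidiagonal signs and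
  differ only by the singlet normalization; both are real, so the adjoint is the transpose.\<close>

lemma mat_adjoint_U_I:
  "mat_adjoint (U_I S) = complex_of_real (sqrt (real S + 1)) \<cdot>\<^sub>m transpose_mat (aklt_Theta S)"
proof (rule eq_matI)
  have U: "U_I S \<in> carrier_mat (S + 1) (S + 1)"
    by (simp add: U_I_def mat_exp_def aux_Sy_def)
  note T = aklt_Theta_carrier[of S]
  show "dim_row (mat_adjoint (U_I S)) = dim_row (complex_of_real (sqrt (real S + 1)) \<cdot>\<^sub>m transpose_mat (aklt_Theta S))"
    "dim_col (mat_adjoint (U_I S)) = dim_col (complex_of_real (sqrt (real S + 1)) \<cdot>\<^sub>m transpose_mat (aklt_Theta S))"
    using U T by (auto simp: mat_adjoint_def)
  fix a b assume "a < dim_row (complex_of_real (sqrt (real S + 1)) \<cdot>\<^sub>m transpose_mat (aklt_Theta S))"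
    "b < dim_col (complex_of_real (sqrt (real S + 1)) \<cdot>\<^sub>m transpose_mat (aklt_Theta S))"
  then have ab: "a \<le> S" "b \<le> S" using T by auto
  then have "mat_adjoint (U_I S) $$ (a, b) = cnj (U_I S $$ (b, a))"
    using U by (simp add: mat_adjoint_def mat_of_rows_index)
  moreover have "(sqrt (real S + 1)) \<noteq> 0" by simp
  ultimately show "mat_adjoint (U_I S) $$ (a, b) =
      (complex_of_real (sqrt (real S + 1)) \<cdot>\<^sub>m transpose_mat (aklt_Theta S)) $$ (a, b)"
    using ab T by (auto simp: U_I_index aklt_Theta_index simp del: real_sqrt_eq_zero_cancel_iff)
qed

theorem mainTheorem4:
  fixes S N n :: nat and c :: complex and bl br :: "complex vec"
  assumes "S \<ge> 1" and "n \<ge> 1" and "odd (N + S)"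
    and "br \<in> carrier_vec (S + 1)"
    and "c \<noteq> 0"
    and "bl = c \<cdot>\<^sub>v (mat_adjoint (U_I S) *\<^sub>v br)"
    and "\<exists>ms\<in>set (configs S (2 * n)). tower_state S (2 * n) N bl br ms \<noteq> 0"
  shows "\<forall>\<mu>. eigenvalue (reduced_density_matrix S n n (tower_state S (2 * n) N bl br)) \<mu> \<and> \<mu> \<noteq> 0 \<longrightarrow>
    even (Polynomial.order \<mu> (char_poly (reduced_density_matrix S n n (tower_state S (2 * n) N bl br))))"
proof (intro allI impI)
  fix \<mu>
  let ?\<psi> = "tower_state S (2 * n) N bl br" and ?d = "length (configs S n)"
  assume "eigenvalue (reduced_density_matrix S n n ?\<psi>) \<mu> \<and> \<mu> \<noteq> 0"
  then have \<mu>: "\<mu> \<noteq> 0" by simp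
  have "bl = (c * complex_of_real (sqrt (real S + 1))) \<cdot>\<^sub>v (transpose_mat (aklt_Theta S) *\<^sub>v br)"
    unfolding assms(6) mat_adjoint_U_I using assms(4) aklt_Theta_carrier[of S]
    by (intro eq_vecI) auto
  then have "?\<psi> (rev ms) = - ?\<psi> ms" if "length ms = 2 * n" for ms
    using tower_state_rev[OF assms(4) _ _ that, of bl _ N] assms(3) by simp
  then obtain X where X: "X \<in> carrier_mat ?d ?d"
    and skew: "\<And>a b. a < ?d \<Longrightarrow> b < ?d \<Longrightarrow> X $$ (b, a) = - X $$ (a, b)"
    and \<rho>: "reduced_density_matrix S n n ?\<psi> = X * transpose_mat (map_mat cnj X)"
    using reduced_density_matrix_antisymmetric by blast
  have "X $$ (a, a) = 0" if "a < ?d" for a using skew[OF that that] by simp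
  then have "alternating_mat ?d X" using X skew unfolding alternating_mat_def by blast
  \<comment> \<open>Conjugation and transposition preserve skew symmetry, so the density matrix is a
    product of two alternating matrices.\<close>
  moreover have "alternating_mat ?d (transpose_mat (map_mat cnj X))"
    unfolding alternating_mat_def
  proof (intro conjI allI impI)
    fix a b assume ab: "a < ?d" "b < ?d"
    show "transpose_mat (map_mat cnj X) $$ (b, a) = - transpose_mat (map_mat cnj X) $$ (a, b)"
      using ab X skew[OF ab] by simp
  next
    fix a assume "a < ?d"
    then show "transpose_mat (map_mat cnj X) $$ (a, a) = 0" using X skew[of a a] by simp
  qed (use X in auto)
  ultimately show "even (Polynomial.order \<mu> (char_poly (reduced_density_matrix S n n ?\<psi>)))"
    unfolding \<rho> using \<mu> by (rule even_order_char_poly_mult_alternating)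
qed

end
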